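(* Let $A\subset\mathbb{R}^n$ be a nonempty, convex and compact set and $B\subset\mathbb{R}^n$ a nonempty, closed and convex set with $A\cap B\neq\varnothing$. Let $(\gamma_k)_{k\in\mathbb{N}}$, $(\theta_k)_{k\in\mathbb{N}}$, $(\lambda_k)_{k\in\mathbb{N}}$ be sequences of nonnegative real numbers for which there are positive real constants $\theta,\sigma$ with $$\theta_k\le\theta<\tfrac12,\qquad 2\gamma_k+4\lambda_k<\sigma<1,\qquad k=0,1,\ldots.$$ For each $k$ let $\varphi_k=\varphi_{\gamma_k,\theta_k,\lambda_k}$ be a relative error tolerance function with forcing parameters $\gamma_k,\theta_k,\lambda_k$. Let $(x^k)_{k\in\mathbb{N}}$ and $(y^k)$ be infinite sequences generated by the ACondG-1 method (i.e. the method never stops). Then $(x^k)$ and $(y^k)$ converge to a (common) point belonging to $A\cap B$.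
   Context: Notation: $\mathbb{N}=\{0,1,2,\ldots\}$; $\langle\cdot,\cdot\rangle$ is the usual inner product and $\|\cdot\|$ the Euclidean norm on $\mathbb{R}^n$; $P_C$ denotes the (exact) Euclidean projection onto a nonempty closed convex set $C$. Relative error tolerance function: for $\gamma,\theta,\lambda\ge 0$, $\varphi_{\gamma,\theta,\lambda}:\mathbb{R}^n\times\mathbb{R}^n\times\mathbb{R}^n\to\mathbb{R}_+$ is any function satisfying $\varphi_{\gamma,\theta,\lambda}(u,v,w)\le\gamma\|v-u\|^2+\theta\|w-v\|^2+\lambda\|w-u\|^2$ for all $u,v,w\in\mathbb{R}^n$. CondG$_C$ procedure (for a compact convex nonempty set $C$, $v\in\mathbb{R}^n$, $u\in C$): start from some $w_0\in C$, $\ell=0$. Step 1: compute $z_\ell\in\arg\min_{z\in C}\langle w_\ell-v,z-w_\ell\rangle$ and $s_\ell^*=\langle w_\ell-v,z_\ell-w_\ell\rangle$. Step 2: if $-s_\ell^*\le\varphi_{\gamma,\theta,\lambda}(u,v,w_\ell)$, stop and output $w^+:=w_\ell$. Step 3: otherwise set $\alpha_\ell=\min\{1,-s_\ell^*/\|z_\ell-w_\ell\|^2\}$, $w_{\ell+1}=w_\ell+\alpha_\ell(z_\ell-w_\ell)$, $\ell\leftarrow\ell+1$, and return to Step 1. The output is written $w^+=\mathrm{CondG}_C(\varphi_{\gamma,\theta,\lambda},u,v)$. (Thus $w^+\in C$ and $\langle v-w^+,z-w^+\rangle\le\varphi_{\gamma,\theta,\lambda}(u,v,w^+)$ for all $z\in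 C$.) ACondG-1 method: Step 0: choose $x^0\in A$; if $x^0\in B$ stop; set $k=0$. Step 1: $y^{k+1}:=P_B(x^k)$; if $y^{k+1}\in A$, stop. Step 2: $x^{k+1}:=\mathrm{CondG}_A(\varphi_k,x^k,y^{k+1})$; if $x^{k+1}\in B$, stop. Step 3: $k\leftarrow k+1$ and go to Step 1. It is assumed that each call of CondG$_A$ terminates with an output. *)

theory Defs
  imports "HOL-Analysis.Analysis"
begin

definition rel_err_tol ::
    "real \<Rightarrow> real \<Rightarrow> real \<Rightarrow> ('a::euclidean_space \<Rightarrow> 'a \<Rightarrow> 'a \<Rightarrow> real) \<Rightarrow> bool" where
  "rel_err_tol \<gamma> \<theta> lam \<phi> \<longleftrightarrow>
     (\<forall>u v w. 0 \<le> \<phi> u v w \<and>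
        \<phi> u v w \<le> \<gamma> * (norm (v - u))\<^sup>2 + \<theta> * (norm (w - v))\<^sup>2 + lam * (norm (w - u))\<^sup>2)"

definition condg_gap :: "'a::euclidean_space \<Rightarrow> 'a \<Rightarrow> 'a \<Rightarrow> real" where
  "condg_gap v w z = (w - v) \<bullet> (z - w)"

definition condg_step :: "'a::euclidean_space \<Rightarrow> 'a \<Rightarrow> 'a \<Rightarrow> 'a" where
  "condg_step v w z = w + min 1 (- condg_gap v w z / (norm (z - w))\<^sup>2) *\<^sub>R (z - w)"

text \<open>
  The conditional gradient procedure is nondeterministic in the starting point \<open>w 0\<close> and
  in the choice of the minimizers \<open>z l\<close>, so it is modelled by a relation: \<open>w'\<close> is
  an output if some run passes the stopping test for the first time at an iteration \<open>N\<close>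
  with \<open>w N = w'\<close>. In particular, every run considered here terminates.
\<close>

definition condg_output ::
    "'a::euclidean_space set \<Rightarrow> ('a \<Rightarrow> 'a \<Rightarrow> 'a \<Rightarrow> real) \<Rightarrow> 'a \<Rightarrow> 'a \<Rightarrow> 'a \<Rightarrow> bool" where
  "condg_output C \<phi> u v w' \<longleftrightarrow>
     (\<exists>w z N. w 0 \<in> C \<and>
        (\<forall>l\<le>N. is_arg_min (condg_gap v (w l)) (\<lambda>y. y \<in> C) (z l)) \<and>
        (\<forall>l<N. \<not> - condg_gap v (w l) (z l) \<le> \<phi> u v (w l) \<and>
               w (Suc l) = condg_step v (w l) (z l)) \<and>
        - condg_gap v (w N) (z N) \<le> \<phi> u v (w N) \<and>
        w' = w N)"

text \<open>
  Infinite executions of the alternating method, i.e. none of the stopping tests ever succeeds.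
  The sequence \<open>y\<close> starts at index 1; the value \<open>y 0\<close> is unconstrained.
\<close>

definition acondg1_seq ::
    "'a::euclidean_space set \<Rightarrow> 'a set \<Rightarrow> (nat \<Rightarrow> 'a \<Rightarrow> 'a \<Rightarrow> 'a \<Rightarrow> real)
      \<Rightarrow> (nat \<Rightarrow> 'a) \<Rightarrow> (nat \<Rightarrow> 'a) \<Rightarrow> bool" where
  "acondg1_seq A B \<phi> x y \<longleftrightarrow>
     x 0 \<in> A \<and> x 0 \<notin> B \<and>
     (\<forall>k. y (Suc k) = closest_point B (x k) \<and> y (Suc k) \<notin> A \<and>
          condg_output A (\<phi> k) (x k) (y (Suc k)) (x (Suc k)) \<and> x (Suc k) \<notin> B)"

end

theory Submission
  imports Defs
begin

text \<open>
  Let \<open>v = P\<^sub>B u\<close> and let \<open>w\<close> be an output of the conditional gradient procedure, so that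
  \<open>\<langle>v - w, z - w\<rangle> \<le> \<phi>\<close> for all \<open>z \<in> A\<close>. Taking \<open>z = p \<in> A \<inter> B\<close> bounds \<open>\<parallel>w - p\<parallel>\<^sup>2\<close> by
  \<open>\<parallel>u - p\<parallel>\<^sup>2 - \<parallel>v - u\<parallel>\<^sup>2 - \<parallel>w - v\<parallel>\<^sup>2 + 2 \<phi>\<close>, where the tolerance involves \<open>\<parallel>w - u\<parallel>\<^sup>2\<close>. The triangle
  inequality is too weak to absorb this term; taking \<open>z = u\<close> instead bounds it by
  \<open>\<parallel>v - u\<parallel>\<^sup>2\<close> and \<open>\<parallel>w - v\<parallel>\<^sup>2\<close> sharply enough to give
  \<open>\<parallel>w - p\<parallel>\<^sup>2 \<le> \<parallel>u - p\<parallel>\<^sup>2 - (1 - \<sigma>) \<parallel>v - u\<parallel>\<^sup>2\<close>. Hence \<open>x\<close> is Fejer monotone with respect to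
  \<open>A \<inter> B\<close> and its distance to \<open>B\<close> tends to \<open>0\<close>, and compactness of \<open>A\<close> yields the limit.
\<close>

text \<open>Minimality of \<open>z\<close> compared with \<open>w\<close> itself makes the gap
  nonpositive, so the step size lies in [0, 1] and the step is a convex combination. For
  \<open>z = w\<close> the quotient is 0 by convention.\<close>

lemma condg_step_in:
  assumes "convex C" "w \<in> C" and z: "is_arg_min (condg_gap v w) (\<lambda>y. y \<in> C) z"
  shows "condg_step v w z \<in> C"
proof -
  let ?t = "min 1 (- condg_gap v w z / (norm (z - w))\<^sup>2)"
  have "z \<in> C" "condg_gap v w z \<le> condg_gap v w w"
    using z \<open>w \<in> C\<close> by (auto simp: is_arg_min_linorder)
  then have "0 \<le> ?t" by (simp add: condg_gap_def divide_nonpos_nonneg)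
  moreover have "condg_step v w z = (1 - ?t) *\<^sub>R w + ?t *\<^sub>R z"
    by (simp add: condg_step_def algebra_simps)
  ultimately show ?thesis
    using convexD_alt[OF assms(1,2) \<open>z \<in> C\<close>, of ?t] by simp
qed

lemma condg_output_in:
  assumes "convex C" "condg_output C \<phi> u v w'"
  shows "w' \<in> C"
proof -
  obtain w z N where w: "w 0 \<in> C" "w' = w N"
    and z: "\<And>l. l \<le> N \<Longrightarrow> is_arg_min (condg_gap v (w l)) (\<lambda>y. y \<in> C) (z l)"
    and step: "\<And>l. l < N \<Longrightarrow> w (Suc l) = condg_step v (w l) (z l)"
    using assms(2) unfolding condg_output_def by blast
  have "w l \<in> C" if "l \<le> N" for l
    using that by (induction l) (auto simp: w step intro: condg_step_in[OF \<open>convex C\<close> _ z])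
  then show ?thesis by (simp add: w)
qed

text \<open>The stopping test only concerns the minimizer \<open>z\<close>, hence it controls every
  point of \<open>C\<close>. With tolerance 0 this would be the variational inequality
  characterizing the projection of \<open>v\<close>.\<close>

lemma condg_output_approx_projection:
  assumes "condg_output C \<phi> u v w" "c \<in> C"
  shows "(v - w) \<bullet> (c - w) \<le> \<phi> u v w"
proof -
  obtain z where z: "is_arg_min (condg_gap v w) (\<lambda>y. y \<in> C) z"
    and "- condg_gap v w z \<le> \<phi> u v w"
    using assms(1) unfolding condg_output_def by blast
  moreover have "condg_gap v w z \<le> condg_gap v w c"
    using z \<open>c \<in> C\<close> by (simp add: is_arg_min_linorder)
  ultimately show ?thesis
    by (simp add: condg_gap_def inner_diff_left)
qed

text \<open>To be read with \<open>a\<close>, \<open>b\<close>, \<open>c\<close> the squared norms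
  of \<open>v - u\<close>, \<open>w - v\<close>, \<open>w - u\<close> and \<open>e\<close> the
  tolerance. The two hypotheses on \<open>e\<close> are coupled through \<open>c\<close>;
  eliminating \<open>c\<close> costs a factor \<open>1 - 2 * lam\<close>, positive since
  \<open>4 * lam < 1\<close>.\<close>

lemma relative_error_absorption:
  fixes a b c :: real
  assumes "0 \<le> a" "0 \<le> b" "0 \<le> \<gamma>" "0 \<le> lam" "\<theta> \<le> 1 / 2"
    and \<sigma>: "2 * \<gamma> + 4 * lam < \<sigma>" "\<sigma> < 1"
    and e: "e \<le> \<gamma> * a + \<theta> * b + lam * c" and bc: "b + c \<le> a + 2 * e"
  shows "2 * e - b \<le> \<sigma> * a"
proof -
  have lam: "0 < 1 - 2 * lam" using assms by linarith
  have "(1 - 2 * lam) * c \<le> (1 + 2 * \<gamma>) * a - (1 - 2 * \<theta>) * b"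
    using e bc by (simp add: algebra_simps)
  then have c: "2 * lam * ((1 - 2 * lam) * c) \<le> 2 * lam * ((1 + 2 * \<gamma>) * a - (1 - 2 * \<theta>) * b)"
    using \<open>0 \<le> lam\<close> by (intro mult_left_mono) auto
  have "(1 - 2 * lam) * (2 * e - b) \<le> (1 - 2 * lam) * (2 * \<gamma> * a + 2 * lam * c - (1 - 2 * \<theta>) * b)"
    using e lam by (intro mult_left_mono) (auto simp: algebra_simps)
  \<comment> \<open>The products with \<open>lam\<close> cancel:
    \<open>(1 - 2 * lam) * 2 * \<gamma> + 2 * lam * (1 + 2 * \<gamma>)\<close> is
    \<open>2 * \<gamma> + 2 * lam\<close>, and likewise the coefficient of \<open>b\<close>.\<close>
  also have "\<dots> \<le> (2 * lam + 2 * \<gamma>) * a - (1 - 2 * \<theta>) * b"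
    using c by (simp add: algebra_simps)
  also have "\<dots> \<le> (2 * lam + 2 * \<gamma>) * a"
    using \<open>0 \<le> b\<close> \<open>\<theta> \<le> 1 / 2\<close> by simp
  also have "\<dots> \<le> ((1 - 2 * lam) * \<sigma>) * a"
  proof (rule mult_right_mono[OF _ \<open>0 \<le> a\<close>])
    \<comment> \<open>Dividing out \<open>1 - 2 * lam\<close> costs at most another
      \<open>2 * lam\<close>, which explains the 4 in the bound on the parameters.\<close>
    have "lam * \<sigma> \<le> lam * 1"
      using \<sigma> \<open>0 \<le> lam\<close> by (intro mult_left_mono) auto
    then show "2 * lam + 2 * \<gamma> \<le> (1 - 2 * lam) * \<sigma>"
      using \<sigma> by (simp add: algebra_simps)
  qed
  finally show ?thesis
    using lam by (simp add: mult.assoc)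
qed

lemma power2_norm_diff_via:
  fixes a b c :: "'a::real_inner"
  shows "(norm (a - c))\<^sup>2 = (norm (a - b))\<^sup>2 + (norm (b - c))\<^sup>2 - 2 * ((a - b) \<bullet> (c - b))"
  by (simp add: power2_norm_eq_inner algebra_simps inner_commute)

lemma acondg1_step_decrease:
  fixes A B :: "'a::euclidean_space set"
  assumes B: "closed B" "convex B" and "p \<in> A" "p \<in> B" "u \<in> A"
    and par: "0 \<le> \<gamma>" "0 \<le> lam" "\<theta> \<le> 1 / 2" "2 * \<gamma> + 4 * lam < \<sigma>" "\<sigma> < 1"
    and tol: "rel_err_tol \<gamma> \<theta> lam \<phi>"
    and v: "v = closest_point B u" and w: "condg_output A \<phi> u v w"
  shows "(norm (w - p))\<^sup>2 \<le> (norm (u - p))\<^sup>2 - (1 - \<sigma>) * (norm (v - u))\<^sup>2"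
proof -
  have proj: "(u - v) \<bullet> (p - v) \<le> 0"
    using closest_point_dot[OF B(2,1) \<open>p \<in> B\<close>] v by simp
  have "(v - w) \<bullet> (p - w) \<le> \<phi> u v w" "(v - w) \<bullet> (u - w) \<le> \<phi> u v w"
    using condg_output_approx_projection[OF w] \<open>p \<in> A\<close> \<open>u \<in> A\<close> by auto
  then have p: "(norm (w - p))\<^sup>2 \<le> (norm (v - p))\<^sup>2 - (norm (w - v))\<^sup>2 + 2 * \<phi> u v w"
    and u: "(norm (w - v))\<^sup>2 + (norm (w - u))\<^sup>2 \<le> (norm (v - u))\<^sup>2 + 2 * \<phi> u v w"
    \<comment> \<open>Both expansions have their vertex at \<open>w\<close>, matching the inner
      products just bounded.\<close>
    using power2_norm_diff_via[of v p w] power2_norm_diff_via[of v u w]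
    by (auto simp: norm_minus_commute)
  have "2 * \<phi> u v w - (norm (w - v))\<^sup>2 \<le> \<sigma> * (norm (v - u))\<^sup>2"
    using tol by (intro relative_error_absorption[OF _ _ par(1-5) _ u]) (auto simp: rel_err_tol_def)
  moreover have "(norm (v - p))\<^sup>2 \<le> (norm (u - p))\<^sup>2 - (norm (v - u))\<^sup>2"
    using power2_norm_diff_via[of u p v] proj by (simp add: norm_minus_commute)
  ultimately show ?thesis
    using p by (simp add: algebra_simps)
qed

text \<open>A cluster point \<open>p\<close> exists by compactness and lies in \<open>S\<close>, so
  the distances to \<open>p\<close> decrease; they vanish along a subsequence, hence along the whole
  sequence.\<close>

lemma fejer_convergent:
  fixes x :: "nat \<Rightarrow> 'a::metric_space"
  assumes "compact K" "\<And>k. x k \<in> K"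
    and cluster: "\<And>r p. \<lbrakk>strict_mono r; (x \<circ> r) \<longlonglongrightarrow> p; p \<in> K\<rbrakk> \<Longrightarrow> p \<in> S"
    and fejer: "\<And>p k. p \<in> S \<Longrightarrow> dist (x (Suc k)) p \<le> dist (x k) p"
  shows "\<exists>p \<in> K \<inter> S. x \<longlonglongrightarrow> p"
proof -
  obtain p r where p: "p \<in> K" "strict_mono (r :: nat \<Rightarrow> nat)" "(x \<circ> r) \<longlonglongrightarrow> p"
    using \<open>compact K\<close> \<open>\<And>k. x k \<in> K\<close> unfolding compact_def by metis
  have "p \<in> S" using cluster p by blast
  have "decseq (\<lambda>k. dist (x k) p)"
    using fejer[OF \<open>p \<in> S\<close>] by (rule decseq_SucI)
  then obtain L where L: "(\<lambda>k. dist (x k) p) \<longlonglongrightarrow> L"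
    using decseq_convergent[of _ 0] by (metis zero_le_dist)
  then have "(\<lambda>k. dist ((x \<circ> r) k) p) \<longlonglongrightarrow> L"
    using LIMSEQ_subseq_LIMSEQ[OF L p(2)] by (simp add: o_def)
  moreover have "(\<lambda>k. dist ((x \<circ> r) k) p) \<longlonglongrightarrow> 0"
    using p(3) by (rule tendsto_dist_iff[THEN iffD1])
  ultimately have "L = 0" by (rule LIMSEQ_unique)
  with L have "x \<longlonglongrightarrow> p" by (simp add: tendsto_dist_iff[of x])
  with \<open>p \<in> K\<close> \<open>p \<in> S\<close> show ?thesis by blast
qed

theorem theorem8:
  fixes A B :: "(real ^ 'n) set"
    and \<gamma> \<theta>s lam :: "nat \<Rightarrow> real"
    and \<theta> \<sigma> :: real
    and \<phi> :: "nat \<Rightarrow> real ^ 'n \<Rightarrow> real ^ 'n \<Rightarrow> real ^ 'n \<Rightarrow> real"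
    and x y :: "nat \<Rightarrow> real ^ 'n"
  assumes "A \<noteq> {}" and "convex A" and "compact A"
    and "B \<noteq> {}" and "closed B" and "convex B"
    and "A \<inter> B \<noteq> {}"
    and "\<And>k. 0 \<le> \<gamma> k" and "\<And>k. 0 \<le> \<theta>s k" and "\<And>k. 0 \<le> lam k"
    and "0 < \<theta>" and "0 < \<sigma>"
    and "\<And>k. \<theta>s k \<le> \<theta>" and "\<theta> < 1 / 2"
    and "\<And>k. 2 * \<gamma> k + 4 * lam k < \<sigma>" and "\<sigma> < 1"
    and "\<And>k. rel_err_tol (\<gamma> k) (\<theta>s k) (lam k) (\<phi> k)"
    and "acondg1_seq A B \<phi> x y"
  shows "\<exists>p \<in> A \<inter> B. x \<longlonglongrightarrow> p \<and> y \<longlonglongrightarrow> p"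
proof -
  have x0: "x 0 \<in> A" and y: "\<And>k. y (Suc k) = closest_point B (x k)"
    and out: "\<And>k. condg_output A (\<phi> k) (x k) (y (Suc k)) (x (Suc k))"
    using \<open>acondg1_seq A B \<phi> x y\<close> unfolding acondg1_seq_def by blast+
  have xA: "x k \<in> A" for k
    by (cases k) (auto intro: x0 condg_output_in[OF \<open>convex A\<close> out])
  have yB: "y (Suc k) \<in> B" for k
    using closest_point_in_set[OF \<open>closed B\<close> \<open>B \<noteq> {}\<close>] y by simp
  have decrease: "(norm (x (Suc k) - p))\<^sup>2
      \<le> (norm (x k - p))\<^sup>2 - (1 - \<sigma>) * (norm (y (Suc k) - x k))\<^sup>2" if "p \<in> A \<inter> B" for p k
  proof -
    have "p \<in> A" "p \<in> B" "\<theta>s k \<le> 1 / 2"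
      using that \<open>\<theta>s k \<le> \<theta>\<close> \<open>\<theta> < 1 / 2\<close> by auto
    then show ?thesis
      by (intro acondg1_step_decrease[OF \<open>closed B\<close> \<open>convex B\<close> _ _ xA \<open>0 \<le> \<gamma> k\<close> \<open>0 \<le> lam k\<close> _
            \<open>2 * \<gamma> k + 4 * lam k < \<sigma>\<close> \<open>\<sigma> < 1\<close> \<open>rel_err_tol (\<gamma> k) (\<theta>s k) (lam k) (\<phi> k)\<close> y out])
  qed
  have fejer: "dist (x (Suc k)) p \<le> dist (x k) p" if "p \<in> A \<inter> B" for p k
  proof -
    have "0 \<le> (1 - \<sigma>) * (norm (y (Suc k) - x k))\<^sup>2"
      using \<open>\<sigma> < 1\<close> by simp
    then have "(norm (x (Suc k) - p))\<^sup>2 \<le> (norm (x k - p))\<^sup>2"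
      using decrease[OF that, of k] by linarith
    then show ?thesis by (simp add: dist_norm)
  qed
  have gap: "(\<lambda>k. y (Suc k) - x k) \<longlonglongrightarrow> 0"
  proof -
    obtain p where p: "p \<in> A \<inter> B" using \<open>A \<inter> B \<noteq> {}\<close> by blast
    let ?d = "\<lambda>k. (norm (x k - p))\<^sup>2"
    have "decseq ?d"
      using fejer[OF p] by (intro decseq_SucI) (simp add: dist_norm)
    then obtain L where L: "?d \<longlonglongrightarrow> L"
      using decseq_convergent[of ?d 0] by auto
    \<comment> \<open>The decrements of a convergent sequence tend to 0, and after scaling they
      dominate the squared gap.\<close>
    have "(\<lambda>k. (?d k - ?d (Suc k)) / (1 - \<sigma>)) \<longlonglongrightarrow> (L - L) / (1 - \<sigma>)"
      using \<open>\<sigma> < 1\<close> L LIMSEQ_Suc[OF L] by (intro tendsto_divide tendsto_diff tendsto_const) auto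
    then have "(\<lambda>k. (?d k - ?d (Suc k)) / (1 - \<sigma>)) \<longlonglongrightarrow> 0" by simp
    moreover have "\<forall>k. norm ((norm (y (Suc k) - x k))\<^sup>2) \<le> (?d k - ?d (Suc k)) / (1 - \<sigma>)"
    proof
      fix k
      show "norm ((norm (y (Suc k) - x k))\<^sup>2) \<le> (?d k - ?d (Suc k)) / (1 - \<sigma>)"
        using decrease[OF p, of k] \<open>\<sigma> < 1\<close> by (simp add: field_simps)
    qed
    ultimately have "(\<lambda>k. (norm (y (Suc k) - x k))\<^sup>2) \<longlonglongrightarrow> 0"
      by (rule Lim_null_comparison[OF always_eventually, rotated])
    then have "(\<lambda>k. sqrt ((norm (y (Suc k) - x k))\<^sup>2)) \<longlonglongrightarrow> sqrt 0"
      by (rule tendsto_real_sqrt)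
    then have "(\<lambda>k. norm (y (Suc k) - x k)) \<longlonglongrightarrow> 0"
      by (simp only: real_sqrt_abs abs_norm_cancel real_sqrt_zero)
    then show ?thesis by (rule tendsto_norm_zero_cancel)
  qed
  have "\<exists>p \<in> A \<inter> (A \<inter> B). x \<longlonglongrightarrow> p"
  proof (rule fejer_convergent[where K = A and S = "A \<inter> B" and x = x, OF \<open>compact A\<close> xA _ fejer])
    fix r p
    assume r: "strict_mono r" and p: "(x \<circ> r) \<longlonglongrightarrow> p" "p \<in> A"
    \<comment> \<open>The vanishing gap carries the limit over to projections, which lie in the
      closed set \<open>B\<close>.\<close>
    have "(\<lambda>k. y (Suc (r k)) - x (r k) + x (r k)) \<longlonglongrightarrow> 0 + p"
      using LIMSEQ_subseq_LIMSEQ[OF gap r] p by (intro tendsto_add) (auto simp: o_def)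
    then have "(\<lambda>k. y (Suc (r k))) \<longlonglongrightarrow> p" by simp
    with yB have "p \<in> B"
      by (rule closed_sequentially[OF \<open>closed B\<close>])
    with \<open>p \<in> A\<close> show "p \<in> A \<inter> B" by blast
  qed
  then obtain p where p: "p \<in> A \<inter> B" "x \<longlonglongrightarrow> p" by blast
  have "(\<lambda>k. y (Suc k)) \<longlonglongrightarrow> p"
    using tendsto_add[OF gap p(2)] by simp
  \<comment> \<open>The unconstrained value \<open>y 0\<close> does not affect the limit.\<close>
  then have "y \<longlonglongrightarrow> p" by (rule LIMSEQ_imp_Suc)
  with p show ?thesis by blast
qed

end
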